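(* Let $\ell > k \geq 3$ with $\ell \geq 6$, and let $n \geq \lfloor \frac{\ell-2}{2} \rfloor$. Then $$sat(K_k^n,C_{\ell}) \leq kn- \ell+1 + \left\lfloor \frac{\ell-2}{2} \right\rfloor ^2 + 2 \left( \ell-1-2 \left\lfloor \frac{\ell-2}{2} \right\rfloor \right) \left\lfloor \frac{\ell-2}{2} \right\rfloor,$$ that is, $sat(K_k^n,C_{\ell}) \le kn + \frac{\ell^2-2\ell-11}{4}$ if $\ell$ is odd and $sat(K_k^n,C_{\ell}) \le kn + \frac{\ell^2-4\ell}{4}$ if $\ell$ is even.
   Context: All graphs are finite, simple and undirected. $K_k^n$ denotes the complete $k$-partite graph with exactly $n$ vertices in each of its $k$ parts. $C_\ell$ denotes the cycle on $\ell$ vertices. For graphs $G$ and $F$, a spanning subgraph $H$ of $G$ is $F$-saturated relative to $G$ if $H$ contains no copy of $F$ but $H+e$ contains a copy of $F$ for every $e\in E(G)\setminus E(H)$; $sat(G,F)$ is the minimum number of edges of a graph that is $F$-saturated relative to $G$. *)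

theory Defs
  imports Complex_Main
begin

text \<open>Graphs are pairs of a vertex set and a set of edges, each edge being a two-element set of
  vertices.\<close>

type_synonym 'a graph = "'a set \<times> 'a set set"

abbreviation verts :: "'a graph \<Rightarrow> 'a set" where
  "verts G \<equiv> fst G"

abbreviation edges :: "'a graph \<Rightarrow> 'a set set" where
  "edges G \<equiv> snd G"

definition simple_graph :: "'a graph \<Rightarrow> bool" where
  "simple_graph G \<longleftrightarrow> finite (verts G) \<and> (\<forall>e\<in>edges G. e \<subseteq> verts G \<and> card e = 2)"

text \<open>Part \<open>i\<close> of the complete \<open>k\<close>-partite graph consists of the pairs \<open>(i, a)\<close> with \<open>a < n\<close>.\<close>

definition complete_multipartite :: "nat \<Rightarrow> nat \<Rightarrow> (nat \<times> nat) graph" where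
  "complete_multipartite k n =
     ({..<k} \<times> {..<n},
      {{(i, a), (j, b)} | i a j b. i < k \<and> j < k \<and> i \<noteq> j \<and> a < n \<and> b < n})"

text \<open>This is the cycle on \<open>l\<close> vertices only for \<open>l \<ge> 3\<close>.\<close>

definition cycle_graph :: "nat \<Rightarrow> nat graph" where
  "cycle_graph l = ({..<l}, {{i, (i + 1) mod l} | i. i < l})"

text \<open>Copies are subgraphs that need not be induced.\<close>

definition contains_copy :: "'a graph \<Rightarrow> 'b graph \<Rightarrow> bool" where
  "contains_copy H F \<longleftrightarrow>
     (\<exists>f. inj_on f (verts F) \<and> f ` verts F \<subseteq> verts H \<and> (\<forall>e\<in>edges F. f ` e \<in> edges H))"

definition spanning_subgraph :: "'a graph \<Rightarrow> 'a graph \<Rightarrow> bool" where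
  "spanning_subgraph H G \<longleftrightarrow> verts H = verts G \<and> edges H \<subseteq> edges G"

definition add_edge :: "'a graph \<Rightarrow> 'a set \<Rightarrow> 'a graph" where
  "add_edge H e = (verts H, insert e (edges H))"

definition saturated_relative :: "'a graph \<Rightarrow> 'a graph \<Rightarrow> 'b graph \<Rightarrow> bool" where
  "saturated_relative H G F \<longleftrightarrow>
     spanning_subgraph H G \<and> \<not> contains_copy H F \<and>
     (\<forall>e\<in>edges G - edges H. contains_copy (add_edge H e) F)"

definition sat :: "'a graph \<Rightarrow> 'b graph \<Rightarrow> nat" where
  "sat G F = (LEAST m. \<exists>H. saturated_relative H G F \<and> card (edges H) = m)"

lemma simple_graph_finite_edges:
  assumes "simple_graph G"
  shows "finite (edges G)"
  using assms by (auto simp: simple_graph_def intro: finite_subset[of _ "Pow (verts G)"])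

lemma simple_complete_multipartite: "simple_graph (complete_multipartite k n)"
  by (auto simp: simple_graph_def complete_multipartite_def card_2_iff)

lemma simple_cycle_graph:
  assumes "l \<ge> 3"
  shows "simple_graph (cycle_graph l)"
proof -
  have "i \<noteq> (i + 1) mod l" if "i < l" for i
    using that assms by (cases "i + 1 = l") auto
  then show ?thesis
    using assms by (auto simp: simple_graph_def cycle_graph_def)
qed

text \<open>The minimum defining \<open>sat\<close> is taken over a nonempty set whenever \<open>F\<close> has an edge.\<close>

lemma sat_attained:
  assumes "simple_graph G" "edges F \<noteq> {}"
  shows "\<exists>H. saturated_relative H G F \<and> card (edges H) = sat G F"
proof -
  define S where "S = {E. E \<subseteq> edges G \<and> \<not> contains_copy (verts G, E) F}"
  have "finite S"
    unfolding S_def using simple_graph_finite_edges[OF assms(1)] by simp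
  moreover have "{} \<in> S"
    using assms(2) by (auto simp: S_def contains_copy_def)
  ultimately obtain E where E: "E \<in> S" "\<And>E'. E' \<in> S \<Longrightarrow> E \<subseteq> E' \<Longrightarrow> E = E'"
    using finite_has_maximal[of S] by (metis empty_iff)
  have "saturated_relative (verts G, E) G F"
    unfolding saturated_relative_def spanning_subgraph_def add_edge_def
  proof (intro conjI ballI)
    fix e assume e: "e \<in> edges G - edges (verts G, E)"
    show "contains_copy (verts (verts G, E), insert e (edges (verts G, E))) F"
    proof (rule ccontr)
      assume "\<not> ?thesis"
      then have "insert e E \<in> S"
        using E(1) e by (simp add: S_def)
      from E(2)[OF this] e show False by auto
    qed
  qed (use E(1) in \<open>auto simp: S_def\<close>)
  then show ?thesis
    unfolding sat_def
    by (intro LeastI_ex[of "\<lambda>m. \<exists>H. saturated_relative H G F \<and> card (edges H) = m"]) blast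
qed

end

theory Submission imports Defs begin

text \<open>Put \<open>m = (l - 2) div 2\<close> and \<open>r = l - 1 - 2 * m\<close>, so that \<open>r\<close> is 1 or 2. The saturated graph has a
  complete tripartite core with parts of sizes \<open>m\<close>, \<open>m\<close>, \<open>r\<close> inside the first three parts of the host
  graph. Every other vertex is pendant: those of part \<open>i\<close> all hang at one core vertex \<open>g i\<close>, and \<open>g\<close> is
  injective. The core has only \<open>l - 1\<close> vertices and no cycle meets a pendant vertex, so there is no
  cycle of length \<open>l\<close>. Any two core vertices are joined by core paths on \<open>l - 1\<close> and on \<open>l - 2\<close>
  vertices; the former close up with a new edge between a pendant and a core vertex, the latter with
  a new edge between two pendant vertices.\<close>

section \<open>Paths in complete tripartite relations\<close>

text \<open>Disjointness of the three parts is implicit: a common element of two parts would be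
  related to itself, against irreflexivity. Later proofs recover it in this way.\<close>

definition tripartite :: "('a \<Rightarrow> 'a \<Rightarrow> bool) \<Rightarrow> 'a set \<Rightarrow> 'a set \<Rightarrow> 'a set \<Rightarrow> bool" where
  "tripartite R A B C \<longleftrightarrow> symp R \<and> irreflp R \<and>
     (\<forall>a\<in>A. \<forall>b\<in>B. R a b) \<and> (\<forall>a\<in>A. \<forall>c\<in>C. R a c) \<and> (\<forall>b\<in>B. \<forall>c\<in>C. R b c)"

lemma tripartite_swap: "tripartite R A B C \<Longrightarrow> tripartite R B A C"
  unfolding tripartite_def by (metis sympD)

lemma tripartite_mono:
  "\<lbrakk>tripartite R A B C; A' \<subseteq> A; B' \<subseteq> B\<rbrakk> \<Longrightarrow> tripartite R A' B' C"
  unfolding tripartite_def by blast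

text \<open>The consecutive pair \<open>u\<close>, \<open>v\<close> is where an induction on the part sizes inserts a new vertex of \<open>B\<close>
  and one of \<open>A\<close>, lengthening the path by 2.\<close>

definition ab_path ::
  "('a \<Rightarrow> 'a \<Rightarrow> bool) \<Rightarrow> 'a set \<Rightarrow> 'a set \<Rightarrow> 'a set \<Rightarrow> 'a \<Rightarrow> 'a \<Rightarrow> nat \<Rightarrow> bool" where
  "ab_path R A B C x y s \<longleftrightarrow> (\<exists>p u v q.
     distinct (p @ u # v # q) \<and> set (p @ u # v # q) \<subseteq> A \<union> B \<union> C \<and>
     successively R (p @ u # v # q) \<and> hd (p @ u # v # q) = x \<and> last (p @ u # v # q) = y \<and>
     length (p @ u # v # q) = s \<and> (u \<in> A \<and> v \<in> B \<or> u \<in> B \<and> v \<in> A))"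

lemma ab_path_swap: "ab_path R B A C x y s \<Longrightarrow> ab_path R A B C x y s"
  unfolding ab_path_def by (metis Un_commute)

lemma ab_path_rev:
  assumes "symp R" "ab_path R A B C x y s"
  shows "ab_path R A B C y x s"
proof -
  obtain p u v q where *: "distinct (p @ u # v # q)" "set (p @ u # v # q) \<subseteq> A \<union> B \<union> C"
     "successively R (p @ u # v # q)" "hd (p @ u # v # q) = x" "last (p @ u # v # q) = y"
     "length (p @ u # v # q) = s" "u \<in> A \<and> v \<in> B \<or> u \<in> B \<and> v \<in> A"
    using assms(2) unfolding ab_path_def by blast
  have r: "rev q @ v # u # rev p = rev (p @ u # v # q)" by simp
  \<comment> \<open>Reversing a list flips the relation; symmetry is needed as an equation of
    functions to rewrite with \<open>successively_rev\<close>.\<close>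
  have "(\<lambda>x y. R y x) = R"
    using assms(1) by (auto simp: fun_eq_iff dest: sympD)
  then have "successively R (rev (p @ u # v # q))"
    using *(3) by (simp only: successively_rev)
  moreover have "hd (rev (p @ u # v # q)) = y" "last (rev (p @ u # v # q)) = x"
    using *(4,5) by (simp_all only: hd_rev last_rev)
  ultimately show ?thesis
    unfolding ab_path_def using *(1,2,6,7)
    by (intro exI[of _ "rev q"] exI[of _ v] exI[of _ u] exI[of _ "rev p"])
       (simp only: r distinct_rev set_rev length_rev, blast)
qed

text \<open>Between \<open>u\<close> and \<open>v\<close> go the two new vertices, in the order that
  keeps \<open>A\<close> and \<open>B\<close> alternating: \<open>u, b, a, v\<close> if
  \<open>u\<close> is in \<open>A\<close>, and \<open>u, a, b, v\<close> if \<open>u\<close> is in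
  \<open>B\<close>. All three new adjacencies then run between \<open>A\<close> and
  \<open>B\<close>.\<close>

lemma ab_path_insert:
  assumes T: "tripartite R A B C" and "ab_path R (A - {a}) (B - {b}) C x y s" "a \<in> A" "b \<in> B"
  shows "ab_path R A B C x y (s + 2)"
proof -
  obtain p u v q where *: "distinct (p @ u # v # q)"
     "set (p @ u # v # q) \<subseteq> (A - {a}) \<union> (B - {b}) \<union> C"
     "successively R (p @ u # v # q)" "hd (p @ u # v # q) = x" "last (p @ u # v # q) = y"
     "length (p @ u # v # q) = s"
     "u \<in> A - {a} \<and> v \<in> B - {b} \<or> u \<in> B - {b} \<and> v \<in> A - {a}"
    using assms(2) unfolding ab_path_def by blast
  have R: "symp R" "\<And>a b. a \<in> A \<Longrightarrow> b \<in> B \<Longrightarrow> R a b" "\<And>x. \<not> R x x"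
    "\<And>a c. a \<in> A \<Longrightarrow> c \<in> C \<Longrightarrow> R a c" "\<And>b c. b \<in> B \<Longrightarrow> c \<in> C \<Longrightarrow> R b c"
    using T unfolding tripartite_def by (auto dest: irreflpD)
  have R': "\<And>a b. a \<in> A \<Longrightarrow> b \<in> B \<Longrightarrow> R b a"
    using R(1,2) by (blast dest: sympD)
  have new: "a \<notin> set (p @ u # v # q)" "b \<notin> set (p @ u # v # q)" "a \<noteq> b"
    using *(2) assms(3,4) R(2-5) by blast+
  \<comment> \<open>The inserted pair becomes the new marked pair, so \<open>u\<close> moves to the
    end of the prefix and \<open>v\<close> to the front of the suffix.\<close>
  define p' u' v' q' where "p' = p @ [u]"
    and "u' = (if u \<in> A \<and> v \<in> B then b else a)"
    and "v' = (if u \<in> A \<and> v \<in> B then a else b)" and "q' = v # q"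
  have uv: "{u', v'} = {a, b}" "R u u'" "R u' v'" "R v' v" "u' \<noteq> v'"
    "u' \<in> A \<and> v' \<in> B \<or> u' \<in> B \<and> v' \<in> A"
    using *(7) R(2) R' assms(3,4) new(3) by (auto simp: u'_def v'_def)
  have "u' \<notin> set (p @ u # v # q)" "v' \<notin> set (p @ u # v # q)"
    using new uv(1) by (metis doubleton_eq_iff)+
  then have "distinct (p' @ u' # v' # q')"
    using *(1) uv(5) by (auto simp: p'_def q'_def)
  moreover have "set (p' @ u' # v' # q') \<subseteq> A \<union> B \<union> C"
    using *(2) uv(6) by (auto simp: p'_def q'_def)
  moreover have "successively R (p' @ u' # v' # q')"
    using *(3) uv(2-4) by (auto simp: p'_def q'_def successively_append_iff successively_Cons)
  moreover have "hd (p' @ u' # v' # q') = x" "last (p' @ u' # v' # q') = y"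
    "length (p' @ u' # v' # q') = s + 2"
    using *(4-6) by (auto simp: p'_def q'_def hd_append)
  ultimately show ?thesis
    unfolding ab_path_def using uv(6) by blast
qed

lemma ab_pathI:
  assumes "distinct (p @ u # v # q)" "set (p @ u # v # q) \<subseteq> A \<union> B \<union> C"
     "successively R (p @ u # v # q)" "hd (p @ u # v # q) = x" "last (p @ u # v # q) = y"
     "length (p @ u # v # q) = s" "u \<in> A \<and> v \<in> B \<or> u \<in> B \<and> v \<in> A"
   shows "ab_path R A B C x y s"
  using assms unfolding ab_path_def by blast

lemma doubletonE:
  assumes "card A = 2" "x \<in> A"
  obtains x' where "A = {x, x'}" "x \<noteq> x'"
  using assms by (metis card_2_iff insert_commute insert_iff singletonD)

text \<open>The smallest core has 4 + \<open>card C\<close> vertices, so \<open>s\<close> asks for a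
  path through all of them or all but one. Explicit paths settle each position of the ends. Swapping
  \<open>A\<close> with \<open>B\<close> and reversing paths reduce everything to \<open>x\<close>
  in \<open>A\<close>, except when both ends lie in \<open>C\<close>.\<close>

lemma ab_path_base:
  assumes T: "tripartite R A B C" and A: "card A = 2" and B: "card B = 2"
    and C: "card C = 1 \<or> card C = 2" and xy: "x \<in> A \<union> B \<union> C" "y \<in> A \<union> B \<union> C" "x \<noteq> y"
    and s: "s = 3 + card C \<or> s = 4 + card C"
  shows "ab_path R A B C x y s"
proof -
  have sym: "symp R"
    using T by (simp add: tripartite_def)
  \<comment> \<open>\<open>path(1)\<close> has the marked pair at the very start,
    \<open>path(2)\<close> has one vertex before it.\<close>
  note path = ab_pathI[where p = "[]"] ab_pathI[where p = "[_]"]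
  \<comment> \<open>\<open>A\<close>, \<open>B\<close>, \<open>x\<close> and \<open>y\<close> are
    generalised here so that the claim also applies with the two parts or the two ends
    exchanged.\<close>
  have inner: "ab_path R A B C x y s"
    if T: "tripartite R A B C" and A: "card A = 2" and B: "card B = 2"
      and xy: "x \<in> A" "y \<in> A \<union> B \<union> C" "x \<noteq> y" for A B x y
  proof -
    have R: "\<And>x. \<not> R x x" "\<And>x y. R x y \<Longrightarrow> R y x"
      "\<And>a b. a \<in> A \<Longrightarrow> b \<in> B \<Longrightarrow> R a b" "\<And>a c. a \<in> A \<Longrightarrow> c \<in> C \<Longrightarrow> R a c"
      "\<And>b c. b \<in> B \<Longrightarrow> c \<in> C \<Longrightarrow> R b c"
      "\<And>a b. a \<in> A \<Longrightarrow> b \<in> B \<Longrightarrow> R b a" "\<And>a c. a \<in> A \<Longrightarrow> c \<in> C \<Longrightarrow> R c a"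
      "\<And>b c. b \<in> B \<Longrightarrow> c \<in> C \<Longrightarrow> R c b"
      using T unfolding tripartite_def by (blast dest: irreflpD sympD)+
    have ne: "A \<inter> B = {}" "A \<inter> C = {}" "B \<inter> C = {}"
      using R by blast+
    obtain a where a: "A = {x, a}" "x \<noteq> a"
      using doubletonE[OF A xy(1)] by metis
    consider "y = a" | "y \<in> B" | "y \<in> C"
      using xy a by blast
    then show ?thesis
    proof cases
      case 1
      obtain b b' where b: "B = {b, b'}" "b \<noteq> b'"
        using B by (metis card_2_iff)
      from C consider c where "C = {c}" | c d where "C = {c, d}" "c \<noteq> d"
        by (metis card_1_singletonE card_2_iff)
      then show ?thesis
      proof cases
        case 1
        with s consider "s = 4" | "s = 5" by auto
        then show ?thesis
        proof cases
          assume "s = 4"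
          then show ?thesis using a b 1 ne R \<open>y = a\<close>
            by (intro path(1)[of x b "[c, a]"]) auto
        next
          assume "s = 5"
          then show ?thesis using a b 1 ne R \<open>y = a\<close>
            by (intro path(1)[of x b "[c, b', a]"]) auto
        qed
      next
        case 2
        with s consider "s = 5" | "s = 6" by auto
        then show ?thesis
        proof cases
          assume "s = 5"
          then show ?thesis using a b 2 ne R \<open>y = a\<close>
            by (intro path(1)[of x b "[c, b', a]"]) auto
        next
          assume "s = 6"
          then show ?thesis using a b 2 ne R \<open>y = a\<close>
            by (intro path(1)[of x b "[c, b', d, a]"]) auto
        qed
      qed
    next
      case y: 2
      obtain b where b: "B = {y, b}" "y \<noteq> b"
        using doubletonE[OF B y] by metis
      from C consider c where "C = {c}" | c d where "C = {c, d}" "c \<noteq> d"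
        by (metis card_1_singletonE card_2_iff)
      then show ?thesis
      proof cases
        case 1
        with s consider "s = 4" | "s = 5" by auto
        then show ?thesis
        proof cases
          assume "s = 4"
          then show ?thesis using a b 1 ne R
            by (intro path(1)[of x b "[a, y]"]) auto
        next
          assume "s = 5"
          then show ?thesis using a b 1 ne R
            by (intro path(1)[of x b "[a, c, y]"]) auto
        qed
      next
        case 2
        with s consider "s = 5" | "s = 6" by auto
        then show ?thesis
        proof cases
          assume "s = 5"
          then show ?thesis using a b 2 ne R
            by (intro path(1)[of x b "[a, c, y]"]) auto
        next
          assume "s = 6"
          then show ?thesis using a b 2 ne R
            by (intro path(1)[of x b "[c, a, d, y]"]) auto
        qed
      qed
    next
      case y: 3
      obtain b b' where b: "B = {b, b'}" "b \<noteq> b'"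
        using B by (metis card_2_iff)
      from C y consider "C = {y}" | d where "C = {y, d}" "y \<noteq> d"
        by (metis card_1_singletonE singletonD doubletonE)
      then show ?thesis
      proof cases
        case 1
        with s consider "s = 4" | "s = 5" by auto
        then show ?thesis
        proof cases
          assume "s = 4"
          then show ?thesis using a b 1 ne R
            by (intro path(1)[of x b "[a, y]"]) auto
        next
          assume "s = 5"
          then show ?thesis using a b 1 ne R
            by (intro path(1)[of x b "[a, b', y]"]) auto
        qed
      next
        case 2
        with s consider "s = 5" | "s = 6" by auto
        then show ?thesis
        proof cases
          assume "s = 5"
          then show ?thesis using a b 2 ne R
            by (intro path(1)[of x b "[a, b', y]"]) auto
        next
          assume "s = 6"
          then show ?thesis using a b 2 ne R
            by (intro ab_pathI[of "[x, d]" b a "[b', y]"]) auto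
        qed
      qed
    qed
  qed
  consider "x \<in> A" | "x \<in> B" | "y \<in> A" | "y \<in> B" | "x \<in> C" "y \<in> C"
    using xy by blast
  then show ?thesis
  proof cases
    case 1
    then show ?thesis using inner[OF T A B] xy by blast
  next
    case 2
    then show ?thesis using inner[OF tripartite_swap[OF T] B A, of x y] xy
      by (blast intro: ab_path_swap)
  next
    case 3
    then show ?thesis using inner[OF T A B, of y x] xy sym
      by (blast intro: ab_path_rev)
  next
    case 4
    then show ?thesis using inner[OF tripartite_swap[OF T] B A, of y x] xy sym
      by (blast intro: ab_path_swap ab_path_rev)
  next
    \<comment> \<open>Two distinct ends in \<open>C\<close> force \<open>C = {x, y}\<close>. Both
      neighbours of the ends lie outside \<open>C\<close>, so the marked pair can start right after
      \<open>x\<close>.\<close>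
    case 5
    then have "card C \<noteq> 1"
      using xy(3) by (metis card_1_singletonE singletonD)
    then have C2: "card C = 2" using C by simp
    obtain d where "C = {x, d}" "x \<noteq> d"
      using doubletonE[OF C2 5(1)] by metis
    then have c: "C = {x, y}" using 5 xy(3) by blast
    obtain a a' where a: "A = {a, a'}" "a \<noteq> a'" using A by (metis card_2_iff)
    obtain b b' where b: "B = {b, b'}" "b \<noteq> b'" using B by (metis card_2_iff)
    have R: "\<And>x. \<not> R x x" "\<And>x y. R x y \<Longrightarrow> R y x"
      "\<And>a b. a \<in> A \<Longrightarrow> b \<in> B \<Longrightarrow> R a b" "\<And>a c. a \<in> A \<Longrightarrow> c \<in> C \<Longrightarrow> R a c"
      "\<And>b c. b \<in> B \<Longrightarrow> c \<in> C \<Longrightarrow> R b c"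
      "\<And>a b. a \<in> A \<Longrightarrow> b \<in> B \<Longrightarrow> R b a" "\<And>a c. a \<in> A \<Longrightarrow> c \<in> C \<Longrightarrow> R c a"
      "\<And>b c. b \<in> B \<Longrightarrow> c \<in> C \<Longrightarrow> R c b"
      using T unfolding tripartite_def by (blast dest: irreflpD sympD)+
    have ne: "A \<inter> B = {}" "A \<inter> C = {}" "B \<inter> C = {}"
      using R by blast+
    from s C2 consider "s = 5" | "s = 6" by auto
    then show ?thesis
    proof cases
      assume "s = 5"
      then show ?thesis using a b c xy(3) ne R
        by (intro path(2)[of x a b "[a', y]"]) auto
    next
      assume "s = 6"
      then show ?thesis using a b c xy(3) ne R
        by (intro path(2)[of x a b "[a', b', y]"]) auto
    qed
  qed
qed

text \<open>Induction on \<open>m\<close>: remove from each of \<open>A\<close> and \<open>B\<close>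
  a vertex that is not an end, take a path two vertices shorter in the smaller core, and insert the
  removed vertices at its marked pair.\<close>

lemma ab_path_exists:
  assumes "m \<ge> 2" "tripartite R A B C" "card A = m" "card B = m" "card C = 1 \<or> card C = 2"
    and "x \<in> A \<union> B \<union> C" "y \<in> A \<union> B \<union> C" "x \<noteq> y"
    and "s + 1 = 2 * m + card C \<or> s = 2 * m + card C"
  shows "ab_path R A B C x y s"
  using assms
proof (induction m arbitrary: A B s rule: dec_induct)
  case base
  then show ?case by (intro ab_path_base) auto
next
  case (step m)
  \<comment> \<open>In the induction step both large parts have at least 3 vertices, so neither is
    contained in \<open>{x, y}\<close>.\<close>
  have "\<exists>a\<in>S. a \<noteq> x \<and> a \<noteq> y" if "card S = Suc m" for S
  proof (rule ccontr)
    assume "\<not> ?thesis"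
    then have "S \<subseteq> {x, y}" by blast
    then have "card S \<le> card {x, y}" by (intro card_mono) auto
    also have "\<dots> = 2" using step.prems by simp
    finally show False using that step.hyps by simp
  qed
  then obtain a b where ab: "a \<in> A" "b \<in> B" "a \<noteq> x" "a \<noteq> y" "b \<noteq> x" "b \<noteq> y"
    using step.prems by metis
  have "ab_path R (A - {a}) (B - {b}) C x y (s - 2)"
  proof (rule step.IH)
    show "tripartite R (A - {a}) (B - {b}) C"
      by (rule tripartite_mono[OF step.prems(1)]) auto
  qed (use step.prems step.hyps ab in auto)
  moreover have "s - 2 + 2 = s"
    using step.prems(8) step.hyps(1) by auto
  ultimately show ?case
    using ab_path_insert[OF step.prems(1) _ ab(1,2), of x y "s - 2"] by simp
qed

section \<open>Copies of cycles\<close>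

lemma contains_cycleI:
  assumes "distinct xs" "length xs = l" "set xs \<subseteq> verts H" "l > 0"
    and "successively (\<lambda>u v. {u, v} \<in> edges H) xs" "{last xs, hd xs} \<in> edges H"
  shows "contains_copy H (cycle_graph l)"
  unfolding contains_copy_def
proof (intro exI[of _ "(!) xs"] conjI ballI)
  show "inj_on ((!) xs) (verts (cycle_graph l))"
    using assms(1,2) by (auto simp: cycle_graph_def inj_on_def nth_eq_iff_index_eq)
  show "(!) xs ` verts (cycle_graph l) \<subseteq> verts H"
    using assms(2,3) by (auto simp: cycle_graph_def)
  fix e assume "e \<in> edges (cycle_graph l)"
  then obtain i where i: "e = {i, (i + 1) mod l}" "i < l"
    by (auto simp: cycle_graph_def)
  show "(!) xs ` e \<in> edges H"
  \<comment> \<open>The edge from \<open>l - 1\<close> back to 0 is the closing edge from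
    \<open>last xs\<close> to \<open>hd xs\<close>; all others join consecutive entries.\<close>
  proof (cases "i + 1 = l")
    case True
    moreover have "xs \<noteq> []" using assms(2,4) by auto
    ultimately show ?thesis
      using assms(2,6) i by (auto simp: last_conv_nth hd_conv_nth)
  next
    case False
    then show ?thesis
      using assms(2,5) i by (auto simp: successively_conv_nth)
  qed
qed

text \<open>The predecessor and the successor on the cycle are distinct because
  \<open>l \<ge> 3\<close>. This keeps vertices of degree one off every cycle.\<close>

lemma cycle_two_neighbours:
  assumes f: "inj_on f {..<l}" "\<And>e. e \<in> edges (cycle_graph l) \<Longrightarrow> f ` e \<in> E"
    and l: "l \<ge> 3" and i: "i < l"
  shows "\<exists>u v. u \<noteq> v \<and> {f i, u} \<in> E \<and> {f i, v} \<in> E"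
proof -
  \<comment> \<open>\<open>j\<close> is the cyclic predecessor of \<open>i\<close>; the case
    \<open>i = 0\<close> is separate because natural subtraction truncates.\<close>
  define j where "j = (if i = 0 then l - 1 else i - 1)"
  have j: "j < l" "(j + 1) mod l = i"
    using l i by (auto simp: j_def)
  have n: "(i + 1) mod l < l" "(i + 1) mod l \<noteq> j"
    using l i by (cases "i + 1 = l"; auto simp: j_def)+
  have "f ` {i, (i + 1) mod l} \<in> E" "f ` {j, (j + 1) mod l} \<in> E"
    using i j(1) by (intro f(2); force simp: cycle_graph_def)+
  moreover have "f ((i + 1) mod l) \<noteq> f j"
    using f(1) n j(1) by (auto dest: inj_onD)
  moreover have "f ` {j, (j + 1) mod l} = {f i, f j}"
    using j(2) by auto
  moreover have "f ` {i, (i + 1) mod l} = {f i, f ((i + 1) mod l)}"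
    by simp
  ultimately show ?thesis by metis
qed

section \<open>The saturated graph: edge count and saturation\<close>

text \<open>\<open>g_part\<close> places the pendant edges in the host graph. \<open>g_inj\<close>
  gives pendant vertices of different parts different attachment vertices, between which a core path
  can then run. The equation for \<open>l\<close> says that the core has \<open>l - 1\<close>
  vertices.\<close>

locale pendant_blow_up =
  fixes k l n m r :: nat and g :: "nat \<Rightarrow> nat \<times> nat"
  assumes k: "k \<ge> 3" and m: "m \<ge> 2" "m \<le> n" and r: "r = 1 \<or> r = 2"
    and l: "l = 2 * m + r + 1"
    and g_inj: "inj_on g {..<k}"
    and g_core: "g ` {..<k} \<subseteq> {0} \<times> {..<m} \<union> {1} \<times> {..<m} \<union> {2} \<times> {..<r}"
    and g_part: "\<And>i. i < k \<Longrightarrow> fst (g i) \<noteq> i"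
begin

definition A :: "(nat \<times> nat) set" where "A = {0} \<times> {..<m}"
definition B :: "(nat \<times> nat) set" where "B = {1} \<times> {..<m}"
definition C :: "(nat \<times> nat) set" where "C = {2} \<times> {..<r}"
definition W :: "(nat \<times> nat) set" where "W = A \<union> B \<union> C"

definition V :: "(nat \<times> nat) set" where "V = {..<k} \<times> {..<n}"

definition core_edges :: "(nat \<times> nat) set set" where
  "core_edges = {{u, v} | u v. u \<in> W \<and> v \<in> W \<and> fst u \<noteq> fst v}"

definition pendant_edges :: "(nat \<times> nat) set set" where
  "pendant_edges = (\<lambda>w. {w, g (fst w)}) ` (V - W)"

definition H :: "(nat \<times> nat) graph" where
  "H = (V, core_edges \<union> pendant_edges)"

lemma finite_W: "finite W"
  by (simp add: W_def A_def B_def C_def)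

lemma card_W: "card W = l - 1"
proof -
  have "card W = card A + card B + card C"
    unfolding W_def by (subst card_Un_disjoint; auto simp: A_def B_def C_def)+
  then show ?thesis by (simp add: A_def B_def C_def card_cartesian_product l)
qed

lemma W_subset_V: "W \<subseteq> V"
  using k m r by (auto simp: W_def V_def A_def B_def C_def)

lemma g_in_W: "i < k \<Longrightarrow> g i \<in> W"
  using g_core by (auto simp: W_def A_def B_def C_def)

lemma card_edges_H: "card (edges H) \<le> m\<^sup>2 + 2 * r * m + (k * n - (l - 1))"
proof -
  \<comment> \<open>\<open>e\<close> forgets the order of a pair. An upper estimate is enough for
    bounding \<open>sat\<close>, so it suffices that the images of the three products of parts cover
    the core edges.\<close>
  define e where "e = (\<lambda>(u :: nat \<times> nat, v). {u, v})"
  have "core_edges \<subseteq> e ` (A \<times> B) \<union> e ` (A \<times> C) \<union> e ` (B \<times> C)"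
  proof
    fix x assume "x \<in> core_edges"
    then obtain u v where "x = {u, v}" "u \<in> W" "v \<in> W" "fst u \<noteq> fst v"
      by (auto simp: core_edges_def)
    moreover from this have parts: "\<not> (u \<in> A \<and> v \<in> A)" "\<not> (u \<in> B \<and> v \<in> B)" "\<not> (u \<in> C \<and> v \<in> C)"
      by (auto simp: A_def B_def C_def)
    ultimately have *: "(u, v) \<in> A \<times> B \<or> (v, u) \<in> A \<times> B \<or> (u, v) \<in> A \<times> C \<or> (v, u) \<in> A \<times> C
      \<or> (u, v) \<in> B \<times> C \<or> (v, u) \<in> B \<times> C"
      unfolding W_def using parts by blast
    have "x = e (u, v)" "x = e (v, u)"
      using \<open>x = {u, v}\<close> by (auto simp: e_def)
    with * show "x \<in> e ` (A \<times> B) \<union> e ` (A \<times> C) \<union> e ` (B \<times> C)"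
      by (elim disjE) (blast intro: image_eqI)+

  qed
  then have "card core_edges \<le> card (e ` (A \<times> B) \<union> e ` (A \<times> C) \<union> e ` (B \<times> C))"
    by (intro card_mono) (auto simp: A_def B_def C_def)
  also have "\<dots> \<le> card (e ` (A \<times> B)) + card (e ` (A \<times> C)) + card (e ` (B \<times> C))"
    by (meson add_le_mono1 card_Un_le le_trans)
  also have "\<dots> \<le> card (A \<times> B) + card (A \<times> C) + card (B \<times> C)"
    by (intro add_mono card_image_le) (auto simp: A_def B_def C_def)
  also have "\<dots> = m\<^sup>2 + 2 * r * m"
    by (simp add: A_def B_def C_def card_cartesian_product power2_eq_square)
  finally have core: "card core_edges \<le> m\<^sup>2 + 2 * r * m" .
  have "card pendant_edges \<le> card (V - W)"
    unfolding pendant_edges_def by (intro card_image_le) (simp add: V_def)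
  also have "\<dots> = card V - card W"
    using finite_W W_subset_V by (rule card_Diff_subset)
  also have "\<dots> = k * n - (l - 1)"
    by (simp add: card_W V_def card_cartesian_product)
  finally show ?thesis
    using core card_Un_le[of core_edges pendant_edges] by (simp add: H_def)
qed

lemma spanning_H: "spanning_subgraph H (complete_multipartite k n)"
proof -
  have *: "{u, v} \<in> edges (complete_multipartite k n)"
    if "u \<in> V" "v \<in> V" "fst u \<noteq> fst v" for u v
  proof -
    have "{u, v} = {(fst u, snd u), (fst v, snd v)}" by simp
    then show ?thesis
      using that unfolding complete_multipartite_def V_def by fastforce
  qed
  have "core_edges \<subseteq> edges (complete_multipartite k n)"
    unfolding core_edges_def using W_subset_V by (auto intro!: *)
  moreover have "{w, g (fst w)} \<in> edges (complete_multipartite k n)" if "w \<in> V" for w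
  proof (rule *)
    have "fst w < k" using that by (auto simp: V_def)
    then show "g (fst w) \<in> V" "fst w \<noteq> fst (g (fst w))"
      using g_in_W W_subset_V g_part by (blast, metis)
  qed (rule that)
  ultimately show ?thesis
    by (auto simp: spanning_subgraph_def H_def pendant_edges_def complete_multipartite_def V_def)
qed

text \<open>Core edges have both ends in \<open>W\<close>, and a pendant edge has its attachment end
  in \<open>W\<close>. An edge at \<open>w\<close> outside \<open>W\<close> is therefore the pendant
  edge of \<open>w\<close> itself.\<close>

lemma pendant_neighbour:
  assumes "w \<notin> W" "{w, u} \<in> edges H"
  shows "u = g (fst w)"
proof -
  have "{w, u} \<notin> core_edges"
    using assms(1) by (auto simp: core_edges_def doubleton_eq_iff)
  then obtain w' where w': "w' \<in> V - W" "{w, u} = {w', g (fst w')}"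
    using assms(2) by (auto simp: H_def pendant_edges_def)
  then have "g (fst w') \<in> W"
    by (intro g_in_W) (auto simp: V_def)
  then show ?thesis
    using w' assms(1) by (auto simp: doubleton_eq_iff)
qed

lemma cycle_free_H: "\<not> contains_copy H (cycle_graph l)"
proof
  assume "contains_copy H (cycle_graph l)"
  then obtain f where f: "inj_on f {..<l}" "\<And>e. e \<in> edges (cycle_graph l) \<Longrightarrow> f ` e \<in> edges H"
    by (auto simp: contains_copy_def cycle_graph_def)
  have l3: "l \<ge> 3" using m l by simp
  have "f i \<in> W" if i: "i < l" for i
  proof -
    obtain u v where "u \<noteq> v" "{f i, u} \<in> edges H" "{f i, v} \<in> edges H"
      using cycle_two_neighbours[OF f l3 i] by blast
    then show ?thesis
      using pendant_neighbour by metis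
  qed
  \<comment> \<open>The \<open>l\<close> distinct cycle vertices would all have to fit into the
    \<open>l - 1\<close> vertices of the core.\<close>
  then have "card (f ` {..<l}) \<le> card W"
    by (intro card_mono finite_W) auto
  then show False
    using f(1) l by (simp add: card_image card_W)
qed

text \<open>Lying in different parts is a tripartite relation on the core, and inside
  \<open>W\<close> it yields edges of \<open>H\<close>. The lengths \<open>l - 2\<close> and
  \<open>l - 1\<close> match \<open>ab_path_exists\<close> because
  \<open>2 * m + r = l - 1\<close>.\<close>

lemma core_path:
  assumes "x \<in> W" "y \<in> W" "x \<noteq> y" "s + 1 = l - 1 \<or> s = l - 1"
  obtains xs where "distinct xs" "set xs \<subseteq> W" "length xs = s" "hd xs = x" "last xs = y"
    "xs \<noteq> []" "successively (\<lambda>u v. {u, v} \<in> edges H) xs"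
proof -
  have "ab_path (\<lambda>u v. fst u \<noteq> fst v) A B C x y s"
  proof (rule ab_path_exists[OF m(1)])
    show "tripartite (\<lambda>u v. fst u \<noteq> fst v) A B C"
      by (auto simp: tripartite_def A_def B_def C_def symp_def irreflp_def)
  qed (use assms r l in \<open>auto simp: W_def A_def B_def C_def card_cartesian_product\<close>)
  then obtain xs where xs: "distinct xs" "set xs \<subseteq> W" "length xs = s" "hd xs = x" "last xs = y"
    "xs \<noteq> []" "successively (\<lambda>u v. fst u \<noteq> fst v) xs"
    unfolding ab_path_def W_def by blast
  have "successively (\<lambda>u v. {u, v} \<in> edges H) xs"
  proof (rule successively_mono[OF xs(7)])
    fix u v assume "u \<in> set xs" "v \<in> set xs" "fst u \<noteq> fst v"
    then have "{u, v} \<in> core_edges"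
      using xs(2) unfolding core_edges_def by blast
    then show "{u, v} \<in> edges H" by (simp add: H_def)
  qed
  with xs that show thesis by blast
qed

lemma saturated_H: "saturated_relative H (complete_multipartite k n) (cycle_graph l)"
  unfolding saturated_relative_def
proof (intro conjI ballI spanning_H cycle_free_H)
  fix e assume e: "e \<in> edges (complete_multipartite k n) - edges H"
  then obtain i a j b where ij: "e = {(i, a), (j, b)}" "i < k" "j < k" "i \<noteq> j" "a < n" "b < n"
    by (auto simp: complete_multipartite_def)
  let ?H = "add_edge H e"
  have l6: "l \<ge> 6" using m r l by auto
  have pend: "{w, g (fst w)} \<in> edges ?H" if "w \<in> V - W" for w
    using that by (auto simp: add_edge_def H_def pendant_edges_def)
  have mono: "successively (\<lambda>u v. {u, v} \<in> edges ?H) xs"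
    if "successively (\<lambda>u v. {u, v} \<in> edges H) xs" for xs
    using that by (rule successively_mono) (auto simp: add_edge_def)
  have V: "verts ?H = V"
    by (simp add: add_edge_def H_def)
  \<comment> \<open>New edge from a pendant \<open>u\<close> to a core vertex \<open>v\<close>: a
    spanning core path from the attachment vertex of \<open>u\<close> to \<open>v\<close> closes
    through \<open>u\<close>. Its ends differ, since otherwise \<open>e\<close> would already be an
    edge.\<close>
  have one: "contains_copy ?H (cycle_graph l)"
    if uv: "e = {u, v}" "u \<in> V - W" "v \<in> W" for u v
  proof -
    have gu: "g (fst u) \<in> W" using uv(2) by (auto simp: V_def intro: g_in_W)
    have "g (fst u) \<noteq> v"
      using e uv by (auto simp: H_def pendant_edges_def)
    then obtain xs where xs: "distinct xs" "set xs \<subseteq> W" "length xs = l - 1"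
      "hd xs = g (fst u)" "last xs = v" "xs \<noteq> []" "successively (\<lambda>u v. {u, v} \<in> edges H) xs"
      using core_path[OF gu uv(3)] by metis
    show ?thesis
    proof (rule contains_cycleI[where xs = "u # xs"])
      show "{last (u # xs), hd (u # xs)} \<in> edges ?H"
        using xs(5,6) uv(1) by (simp add: add_edge_def insert_commute)
      show "successively (\<lambda>u v. {u, v} \<in> edges ?H) (u # xs)"
        using mono[OF xs(7)] xs(4) pend[OF uv(2)] by (simp add: successively_Cons)
    qed (use xs uv W_subset_V V l6 in auto)
  qed
  \<comment> \<open>New edge between pendant vertices: a core path on \<open>l - 2\<close> vertices
    joins their attachment vertices, and \<open>u\<close> and \<open>v\<close> complete it to
    \<open>l\<close>.\<close>
  have two: "contains_copy ?H (cycle_graph l)"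
    if uv: "e = {u, v}" "u \<in> V - W" "v \<in> V - W" "fst u \<noteq> fst v" for u v
  proof -
    have gu: "g (fst u) \<in> W" "g (fst v) \<in> W"
      using uv(2,3) by (auto simp: V_def intro: g_in_W)
    have "fst u < k" "fst v < k"
      using uv(2,3) by (auto simp: V_def)
    then have "g (fst u) \<noteq> g (fst v)"
      using g_inj uv(4) by (auto dest: inj_onD)
    moreover have "l - 2 + 1 = l - 1" using l6 by simp
    ultimately obtain xs where xs: "distinct xs" "set xs \<subseteq> W" "length xs = l - 2"
      "hd xs = g (fst u)" "last xs = g (fst v)" "xs \<noteq> []"
      "successively (\<lambda>u v. {u, v} \<in> edges H) xs"
      using core_path[OF gu] by metis
    show ?thesis
    proof (rule contains_cycleI[where xs = "u # xs @ [v]"])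
      show "{last (u # xs @ [v]), hd (u # xs @ [v])} \<in> edges ?H"
        using uv(1) by (simp add: add_edge_def insert_commute)
      show "successively (\<lambda>u v. {u, v} \<in> edges ?H) (u # xs @ [v])"
        using mono[OF xs(7)] xs(4-6) pend[OF uv(2)] pend[OF uv(3)]
        by (simp add: successively_Cons successively_append_iff insert_commute)
    qed (use xs uv W_subset_V V l6 in auto)
  qed
  have "(i, a) \<in> V" "(j, b) \<in> V"
    using ij by (auto simp: V_def)
  \<comment> \<open>The core is complete tripartite, so no missing edge has both ends in it.\<close>
  moreover have "\<not> ((i, a) \<in> W \<and> (j, b) \<in> W)"
  proof
    assume "(i, a) \<in> W \<and> (j, b) \<in> W"
    with ij have "e \<in> core_edges" by (auto simp: core_edges_def)
    with e show False by (simp add: H_def)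
  qed
  moreover have "e = {(j, b), (i, a)}" using ij(1) by (simp add: insert_commute)
  ultimately show "contains_copy ?H (cycle_graph l)"
    using one[OF ij(1)] one[of "(j, b)" "(i, a)"] two[OF ij(1)] ij(4) by auto
qed

lemma sat_upper_bound:
  "sat (complete_multipartite k n) (cycle_graph l) \<le> m\<^sup>2 + 2 * r * m + (k * n - (l - 1))"
proof -
  have "sat (complete_multipartite k n) (cycle_graph l) \<le> card (edges H)"
    unfolding sat_def by (rule Least_le) (use saturated_H in blast)
  then show ?thesis using card_edges_H by linarith
qed

text \<open>Ensures that the natural subtraction \<open>k * n - (l - 1)\<close> does not truncate
  when the bound is read over the integers.\<close>

lemma core_size_le: "l - 1 \<le> k * n"
  using card_mono[OF _ W_subset_V] by (simp add: card_W V_def card_cartesian_product)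

end

section \<open>Choice of attachment vertices and the final bound\<close>

text \<open>Only parts 0, 1 and 2 meet the core, so only they restrict \<open>g\<close>; a cyclic
  shift serves them. The other parts take any distinct core vertices that remain, and
  \<open>k \<le> 2 * m + r\<close> leaves enough.\<close>

lemma attachment_exists:
  fixes k m r :: nat
  assumes "k \<ge> 3" "m \<ge> 2" "r \<ge> 1" "k \<le> 2 * m + r"
  shows "\<exists>g :: nat \<Rightarrow> nat \<times> nat. inj_on g {..<k} \<and>
    g ` {..<k} \<subseteq> {0} \<times> {..<m} \<union> {1} \<times> {..<m} \<union> {2} \<times> {..<r} \<and> (\<forall>i<k. fst (g i) \<noteq> i)"
proof -
  define W :: "(nat \<times> nat) set" where "W = {0} \<times> {..<m} \<union> {1} \<times> {..<m} \<union> {2} \<times> {..<r}"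
  define S :: "(nat \<times> nat) set" where "S = {(1, 0), (2, 0), (0, 0)}"
  have fin: "finite W" by (simp add: W_def)
  have "card W = 2 * m + r"
    unfolding W_def
    by (subst card_Un_disjoint; (auto simp: card_cartesian_product)?)+
  moreover have SW: "S \<subseteq> W" using assms by (auto simp: S_def W_def)
  moreover have "card S = 3" by (simp add: S_def)
  ultimately have "card {3..<k} \<le> card (W - S)"
    using assms fin by (subst card_Diff_subset) (auto simp: S_def)
  then obtain h where h: "h ` {3..<k} \<subseteq> W - S" "inj_on h {3..<k}"
    using card_le_inj[of "{3..<k}" "W - S"] fin by auto
  define g where "g i = (if i = 0 then (1, 0) else if i = 1 then (2, 0) else if i = 2 then (0, 0)
    else h i)" for i
  have small: "g ` {..<3} = S" "inj_on g {..<3}"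
    by (auto simp: g_def S_def inj_on_def lessThan_nat_numeral lessThan_Suc)
  have gh: "g i = h i" if "i \<ge> 3" for i
    using that by (simp add: g_def)
  have large: "g ` {3..<k} \<subseteq> W - S" "inj_on g {3..<k}"
    using h gh by (auto simp: inj_on_def)
  have split: "{..<k} = {..<3} \<union> {3..<k}"
    using assms(1) by auto
  have "inj_on g {..<k}"
    unfolding split inj_on_Un using small large by blast
  moreover have W: "g ` {..<k} \<subseteq> W"
    unfolding split image_Un using small large SW by blast
  moreover have "fst (g i) \<noteq> i" if "i < k" for i
  proof (cases "i \<ge> 3")
    case True
    have "g i \<in> W" using W that by blast
    then show ?thesis using True by (auto simp: W_def)
  next
    case False
    then have "i = 0 \<or> i = 1 \<or> i = 2" by auto
    then show ?thesis by (auto simp: g_def)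
  qed
  ultimately show ?thesis unfolding W_def by blast
qed

theorem theorem1p3:
  fixes k l n :: nat
  assumes "k \<ge> 3" and "l > k" and "l \<ge> 6"
    and "int n \<ge> \<lfloor>(real l - 2) / 2\<rfloor>"
  shows "int (sat (complete_multipartite k n) (cycle_graph l))
           \<le> int k * int n - int l + 1 + \<lfloor>(real l - 2) / 2\<rfloor> ^ 2
             + 2 * (int l - 1 - 2 * \<lfloor>(real l - 2) / 2\<rfloor>) * \<lfloor>(real l - 2) / 2\<rfloor>
       \<and> (odd l \<longrightarrow> real (sat (complete_multipartite k n) (cycle_graph l))
           \<le> real k * real n + (real l ^ 2 - 2 * real l - 11) / 4)
       \<and> (even l \<longrightarrow> real (sat (complete_multipartite k n) (cycle_graph l))
           \<le> real k * real n + (real l ^ 2 - 4 * real l) / 4)"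
proof -
  \<comment> \<open>\<open>r\<close> is 2 for odd \<open>l\<close> and 1 for even \<open>l\<close>.
    With \<open>l = 2 * m + r + 1\<close>, the hypothesis \<open>l > k\<close> becomes the size
    condition \<open>k \<le> 2 * m + r\<close> of \<open>attachment_exists\<close>.\<close>
  define m r where "m = (l - 2) div 2" and "r = l - 1 - 2 * m"
  have floor: "\<lfloor>(real l - 2) / 2\<rfloor> = int m"
    using floor_divide_of_nat_eq[of "l - 2" 2, where ?'a = real] assms(3)
    by (simp add: m_def of_nat_diff)
  have m: "m \<ge> 2" "m \<le> n" and r: "r = 1 \<or> r = 2" and l: "l = 2 * m + r + 1"
    using assms floor unfolding r_def m_def by (simp_all, presburger+)
  obtain g where "inj_on g {..<k}" "\<forall>i<k. fst (g i) \<noteq> i"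
    "g ` {..<k} \<subseteq> {0} \<times> {..<m} \<union> {1} \<times> {..<m} \<union> {2} \<times> {..<r}"
    using attachment_exists[of k m r] assms(1,2) m r l by auto
  then interpret pendant_blow_up k l n m r g
    using assms(1) m r l by unfold_locales auto
  define s where "s = sat (complete_multipartite k n) (cycle_graph l)"
  have "int s \<le> int (m\<^sup>2 + 2 * r * m + (k * n - (l - 1)))"
    using sat_upper_bound by (simp only: s_def of_nat_le_iff)
  then have bound: "int s \<le> int k * int n - int l + 1 + int m ^ 2 + 2 * int r * int m"
    using core_size_le l by (simp add: of_nat_diff)
  have r': "int l - 1 - 2 * int m = int r" using l by simp
  have "real_of_int (int s) \<le>
      real_of_int (int k * int n - int l + 1 + int m ^ 2 + 2 * int r * int m)"
    using bound by (simp only: of_int_le_iff)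
  then have real: "real s \<le> real k * real n - real l + 1 + real m ^ 2 + 2 * real r * real m"
    by simp
  have "odd l \<Longrightarrow> r = 2" "even l \<Longrightarrow> r = 1"
    using r l by auto
  \<comment> \<open>Substituting \<open>m = (l - 3) / 2\<close> for odd \<open>l\<close> and
    \<open>m = (l - 2) / 2\<close> for even \<open>l\<close> gives the two closed forms.\<close>
  then have "odd l \<longrightarrow> real s \<le> real k * real n + (real l ^ 2 - 2 * real l - 11) / 4"
    "even l \<longrightarrow> real s \<le> real k * real n + (real l ^ 2 - 4 * real l) / 4"
    using real l by (auto simp: power2_eq_square field_simps)
  then show ?thesis
    using bound unfolding floor r' s_def by blast
qed

end
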